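(* There does not exist a constant $\Gamma>0$ such that $$COST(z^*_{FA},c^*_{UF})\le\Gamma\cdot COST(z^*,c^* )$$ for all instances of the minimum representation fair clustering problem (in the $k$-means setting, and likewise in the $k$-medians setting). That is, fairly assigning the data points to the optimal unfair centers can have cost arbitrarily large relative to the optimal value of the minimum representation fair clustering problem.
   Context: Setting. An instance consists of $n$ indexed points $\mathcal X=\{x^1,\dots,x^n\}\subset\mathbb R^m$ (distinct indices may carry the same location); a finite set $\mathcal F$ of sensitive features, each $f\in\mathcal F$ with a finite set of values $\mathcal G_f$, with $\mathcal G=\bigcup_f\mathcal G_f$ the set of groups and $X_g$ the set of data points in group $g$, where $\{X_g\}_{g\in\mathcal G_f}$ partitions $\mathcal X$ for each $f$; a number $K$ of clusters with $\mathcal K=\{1,\dots,K\}$; parameters $\alpha\in(0,1]$ and nonnegative integers $\beta_g$; a cost function $D$. In the $k$-means setting $D(x,c)=\|x-c\|_2^2$ and centers may be any points of $\mathbb R^m$; in the $k$-medians setting $D$ is any given distance function (part of the instance) and the center of a cluster must be a data point of that cluster. A clustering is an assignment $z=(z_{ik})\in\{0,1\}^{n\times K}$ with $\sum_k z_{ik}=1$ for all $i$ and every cluster $C_k=\{x^i:z_{ik}=1\}$ nonempty. It is a fair assignment if for every $g\in\mathcal G$ there are at least $\beta_g$ indices $k$ with $|C_k\cap X_g|\ge\alpha|C_k|$. For an assignment $z$ and centers $c=(c_1,\dots,c_K)$, $COST(z,c)=\sum_{i}\sum_{k\in\mathcal K}D(x^i,c_k)z_{ik}$. $(z^*,c^*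 )$ is an optimal solution of the MR-fair clustering problem (minimize $COST(z,c)$ over fair assignments $z$ and admissible centers $c$). $c^*_{UF}$ are optimal centers for the clustering problem without the fairness constraints. $z^*_{FA}$ is an optimal fair assignment of the data points to the fixed centers $c^*_{UF}$, i.e. it minimizes $COST(z,c^*_{UF})$ over all fair assignments $z$. *)

theory Defs
  imports "HOL-Analysis.Analysis"
begin

(* R^m, with m part of the instance, is the carrier of the library space Euclidean_space m. *)
abbreviation euclid :: "nat \<Rightarrow> (nat \<Rightarrow> real) set" where
  "euclid m \<equiv> topspace (Euclidean_space m)"

type_synonym point = "nat \<Rightarrow> real"
type_synonym assignment = "nat \<Rightarrow> nat \<Rightarrow> nat"
type_synonym centers = "nat \<Rightarrow> point"

(* Data points are handled through their indices 1..n, because distinct indices may carry the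
   same location; in particular members I g is the set of indices of the points in group g.
   Features and groups are named by natural numbers. *)
record mrfc =
  dim :: nat
  npoints :: nat
  pt :: "nat \<Rightarrow> point"
  features :: "nat set"
  vals :: "nat \<Rightarrow> nat set"
  members :: "nat \<Rightarrow> nat set"
  nclusters :: nat
  alpha :: real
  beta :: "nat \<Rightarrow> nat"
  cost_fn :: "point \<Rightarrow> point \<Rightarrow> real"

datatype setting = KMeans | KMedians

definition indices :: "mrfc \<Rightarrow> nat set" where
  "indices I = {1..npoints I}"

definition clusters :: "mrfc \<Rightarrow> nat set" where
  "clusters I = {1..nclusters I}"

definition groups :: "mrfc \<Rightarrow> nat set" where
  "groups I = (\<Union>f\<in>features I. vals I f)"

fun cost_fn_ok :: "setting \<Rightarrow> mrfc \<Rightarrow> bool" where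
  "cost_fn_ok KMeans I \<longleftrightarrow>
     (\<forall>x\<in>euclid (dim I). \<forall>c\<in>euclid (dim I).
        cost_fn I x c = (L2_set (\<lambda>j. x j - c j) {..<dim I})\<^sup>2)"
| "cost_fn_ok KMedians I \<longleftrightarrow> Metric_space (euclid (dim I)) (cost_fn I)"

definition mrfc_inst :: "setting \<Rightarrow> mrfc \<Rightarrow> bool" where
  "mrfc_inst s I \<longleftrightarrow>
     1 \<le> dim I \<and> 1 \<le> npoints I \<and> 1 \<le> nclusters I \<and>
     (\<forall>i\<in>indices I. pt I i \<in> euclid (dim I)) \<and>
     finite (features I) \<and>
     (\<forall>f\<in>features I. finite (vals I f) \<and>
        inj_on (members I) (vals I f) \<and>
        partition_on (indices I) (members I ` vals I f)) \<and>
     0 < alpha I \<and> alpha I \<le> 1 \<and>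
     cost_fn_ok s I"

definition cluster :: "mrfc \<Rightarrow> assignment \<Rightarrow> nat \<Rightarrow> nat set" where
  "cluster I z k = {i \<in> indices I. z i k = 1}"

definition clustering :: "mrfc \<Rightarrow> assignment \<Rightarrow> bool" where
  "clustering I z \<longleftrightarrow>
     (\<forall>i\<in>indices I. \<forall>k\<in>clusters I. z i k \<in> {0, 1}) \<and>
     (\<forall>i\<in>indices I. (\<Sum>k\<in>clusters I. z i k) = 1) \<and>
     (\<forall>k\<in>clusters I. cluster I z k \<noteq> {})"

definition fair_assignment :: "mrfc \<Rightarrow> assignment \<Rightarrow> bool" where
  "fair_assignment I z \<longleftrightarrow> clustering I z \<and>
     (\<forall>g\<in>groups I. beta I g \<le>
        card {k \<in> clusters I.
          real (card (cluster I z k \<inter> members I g)) \<ge> alpha I * real (card (cluster I z k))})"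

fun admissible :: "setting \<Rightarrow> mrfc \<Rightarrow> assignment \<Rightarrow> centers \<Rightarrow> bool" where
  "admissible KMeans I z c \<longleftrightarrow> (\<forall>k\<in>clusters I. c k \<in> euclid (dim I))"
| "admissible KMedians I z c \<longleftrightarrow> (\<forall>k\<in>clusters I. \<exists>i\<in>cluster I z k. c k = pt I i)"

definition COST :: "mrfc \<Rightarrow> assignment \<Rightarrow> centers \<Rightarrow> real" where
  "COST I z c = (\<Sum>i\<in>indices I. \<Sum>k\<in>clusters I. cost_fn I (pt I i) (c k) * real (z i k))"

definition optimal_fair_solution :: "setting \<Rightarrow> mrfc \<Rightarrow> assignment \<Rightarrow> centers \<Rightarrow> bool" where
  "optimal_fair_solution s I z c \<longleftrightarrow>
     is_arg_min (\<lambda>(z, c). COST I z c) (\<lambda>(z, c). fair_assignment I z \<and> admissible s I z c) (z, c)"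

definition optimal_unfair_centers :: "setting \<Rightarrow> mrfc \<Rightarrow> centers \<Rightarrow> bool" where
  "optimal_unfair_centers s I c \<longleftrightarrow>
     (\<exists>z. is_arg_min (\<lambda>(z, c). COST I z c) (\<lambda>(z, c). clustering I z \<and> admissible s I z c) (z, c))"

(* The centers are fixed here, so in the k-medians setting they need not be members of the
   clusters of z. *)
definition optimal_fair_assignment_to :: "mrfc \<Rightarrow> centers \<Rightarrow> assignment \<Rightarrow> bool" where
  "optimal_fair_assignment_to I c z \<longleftrightarrow>
     is_arg_min (\<lambda>z. COST I z c) (fair_assignment I) z"

(* Optimal solutions can exist only if some fair assignment does. *)
definition feasible_inst :: "setting \<Rightarrow> mrfc \<Rightarrow> bool" where
  "feasible_inst s I \<longleftrightarrow> mrfc_inst s I \<and> (\<exists>z. fair_assignment I z)"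

(* The remainder shows that every feasible instance has all three kinds of optimal solutions
   (optima_exist), so a choice of optimal solutions for all feasible instances is possible. *)

lemma is_arg_min_exists_finite:
  fixes f :: "'a \<Rightarrow> real"
  assumes "P x" "finite (f ` Collect P)"
  shows "\<exists>x. is_arg_min f P x"
proof -
  have "Min (f ` Collect P) \<in> f ` Collect P" using assms by (intro Min_in) auto
  then obtain y where "P y" "f y = Min (f ` Collect P)" by auto
  then have "is_arg_min f P y" using assms(2) unfolding is_arg_min_def
    by (metis Min_le imageI leD mem_Collect_eq)
  then show ?thesis by blast
qed

definition restrict_assignment :: "mrfc \<Rightarrow> assignment \<Rightarrow> assignment" where
  "restrict_assignment I z = restrict (\<lambda>i. restrict (z i) (clusters I)) (indices I)"

lemma finite_indices_clusters [simp]: "finite (indices I)" "finite (clusters I)"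
  by (auto simp: indices_def clusters_def)

lemma finite_assignments: "finite (restrict_assignment I ` {z. clustering I z})"
proof (rule finite_subset)
  show "restrict_assignment I ` {z. clustering I z} \<subseteq> (\<Pi>\<^sub>E i\<in>indices I. \<Pi>\<^sub>E k\<in>clusters I. {0,1})"
    unfolding restrict_assignment_def clustering_def by fastforce
qed (auto intro!: finite_PiE)

lemma COST_restrict: "COST I (restrict_assignment I z) c = COST I z c"
  unfolding COST_def restrict_assignment_def by (intro sum.cong) auto

lemma COST_cong_c: "(\<And>k. k \<in> clusters I \<Longrightarrow> c k = c' k) \<Longrightarrow> COST I z c = COST I z c'"
  unfolding COST_def by (intro sum.cong) auto

lemma finite_COST_fixed_centers:
  assumes "\<And>z. P z \<Longrightarrow> clustering I z"
  shows "finite ((\<lambda>z. COST I z c) ` Collect P)"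
proof (rule finite_subset)
  show "(\<lambda>z. COST I z c) ` Collect P \<subseteq> (\<lambda>z. COST I z c) ` (restrict_assignment I ` {z. clustering I z})"
    using assms COST_restrict by (force simp: image_image)
qed (intro finite_imageI finite_assignments)

lemma weighted_mean_le:
  fixes w x :: "'a \<Rightarrow> real"
  assumes "finite A" "\<And>i. i \<in> A \<Longrightarrow> w i \<ge> 0"
  shows "(\<Sum>i\<in>A. w i * (x i - (\<Sum>i\<in>A. w i * x i) / (\<Sum>i\<in>A. w i))\<^sup>2) \<le> (\<Sum>i\<in>A. w i * (x i - c)\<^sup>2)"
proof (cases "sum w A = 0")
  case True
  then have "\<forall>i\<in>A. w i = 0" using assms by (simp add: sum_nonneg_eq_0_iff)
  then show ?thesis by simp
next
  case False
  define a where "a = (\<Sum>i\<in>A. w i * x i) / (\<Sum>i\<in>A. w i)"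
  have z: "(\<Sum>i\<in>A. w i * (x i - a)) = 0"
  proof -
    have "(\<Sum>i\<in>A. w i * (x i - a)) = (\<Sum>i\<in>A. w i * x i) - sum w A * a"
      by (simp add: right_diff_distrib sum_subtractf sum_distrib_right)
    then show ?thesis using False by (simp add: a_def)
  qed
  have "(\<Sum>i\<in>A. w i * (x i - c)\<^sup>2) =
     (\<Sum>i\<in>A. w i * (x i - a)\<^sup>2 + 2 * (a - c) * (w i * (x i - a)) + w i * (a - c)\<^sup>2)"
    by (intro sum.cong) (auto simp: power2_eq_square algebra_simps)
  also have "\<dots> = (\<Sum>i\<in>A. w i * (x i - a)\<^sup>2) + 2 * (a - c) * (\<Sum>i\<in>A. w i * (x i - a)) + (\<Sum>i\<in>A. w i * (a - c)\<^sup>2)"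
    by (simp add: sum.distrib sum_distrib_left)
  also have "\<dots> \<ge> (\<Sum>i\<in>A. w i * (x i - a)\<^sup>2)" using z assms by (simp add: sum_nonneg)
  finally show ?thesis by (simp add: a_def)
qed

definition cluster_mean :: "mrfc \<Rightarrow> assignment \<Rightarrow> centers" where
  "cluster_mean I z k j = (\<Sum>i\<in>indices I. real (z i k) * pt I i j) / (\<Sum>i\<in>indices I. real (z i k))"

lemma kmeans_cluster_mean:
  assumes "mrfc_inst KMeans I"
  shows "admissible KMeans I z (cluster_mean I z)"
   and "admissible KMeans I z c \<Longrightarrow> COST I z (cluster_mean I z) \<le> COST I z c"
proof -
  have pts: "\<And>i. i \<in> indices I \<Longrightarrow> pt I i \<in> euclid (dim I)" using assms by (auto simp: mrfc_inst_def)
  show adm: "admissible KMeans I z (cluster_mean I z)" using pts by (auto simp: cluster_mean_def topspace_Euclidean_space)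
  have *: "COST I z c = (\<Sum>k\<in>clusters I. \<Sum>j<dim I. \<Sum>i\<in>indices I. real (z i k) * (pt I i j - c k j)\<^sup>2)"
    if "admissible KMeans I z c" for c
  proof -
    have "COST I z c = (\<Sum>i\<in>indices I. \<Sum>k\<in>clusters I. \<Sum>j<dim I. real (z i k) * (pt I i j - c k j)\<^sup>2)"
      unfolding COST_def using that pts assms
      by (intro sum.cong refl)
        (auto simp: mrfc_inst_def L2_set_def sum_nonneg sum_distrib_right mult.commute sum_distrib_left)
    also have "\<dots> = (\<Sum>k\<in>clusters I. \<Sum>i\<in>indices I. \<Sum>j<dim I. real (z i k) * (pt I i j - c k j)\<^sup>2)"
      by (rule sum.swap)
    also have "\<dots> = (\<Sum>k\<in>clusters I. \<Sum>j<dim I. \<Sum>i\<in>indices I. real (z i k) * (pt I i j - c k j)\<^sup>2)"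
      by (intro sum.cong refl sum.swap)
    finally show ?thesis .
  qed
  show "COST I z (cluster_mean I z) \<le> COST I z c" if "admissible KMeans I z c"
    unfolding *[OF that] *[OF adm] cluster_mean_def by (intro sum_mono weighted_mean_le) auto
qed

lemma exists_optimal_solution:
  assumes I: "mrfc_inst s I" and P: "\<And>z. P z \<Longrightarrow> clustering I z" and z0: "P z0"
  shows "\<exists>z c. is_arg_min (\<lambda>(z, c). COST I z c) (\<lambda>(z, c). P z \<and> admissible s I z c) (z, c)"
proof (cases s)
  case KMeans
  have "finite ((\<lambda>z. COST I z (cluster_mean I z)) ` Collect P)"
  proof (rule finite_subset)
    have "cluster_mean I (restrict_assignment I z) k = cluster_mean I z k" if "k \<in> clusters I" for z k
      using that unfolding cluster_mean_def restrict_assignment_def by (intro ext arg_cong2[where f="(/)"] sum.cong) auto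
    then have "COST I z (cluster_mean I z) = COST I (restrict_assignment I z) (cluster_mean I (restrict_assignment I z))" for z
      by (metis COST_restrict COST_cong_c)
    then show "(\<lambda>z. COST I z (cluster_mean I z)) ` Collect P \<subseteq> (\<lambda>z. COST I z (cluster_mean I z)) ` (restrict_assignment I ` {z. clustering I z})"
      using P by (force simp: image_image)
  qed (intro finite_imageI finite_assignments)
  from is_arg_min_exists_finite[where P=P, OF z0 this] obtain z
    where z: "is_arg_min (\<lambda>z. COST I z (cluster_mean I z)) P z" by blast
  have "is_arg_min (\<lambda>(z, c). COST I z c) (\<lambda>(z, c). P z \<and> admissible s I z c) (z, cluster_mean I z)"
    using z kmeans_cluster_mean[of I] I KMeans unfolding is_arg_min_def
    by (auto simp del: admissible.simps) (meson dual_order.strict_trans2 le_less_trans)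
  then show ?thesis by blast
next
  case KMedians
  let ?Q = "\<lambda>(z, c). P z \<and> admissible s I z c"
  let ?f = "\<lambda>(z, c). COST I z c"
  let ?S = "(restrict_assignment I ` {z. clustering I z}) \<times> (\<Pi>\<^sub>E k\<in>clusters I. pt I ` indices I)"
  have "\<forall>k\<in>clusters I. \<exists>i. i \<in> cluster I z0 k" using P[OF z0] by (auto simp: clustering_def)
  then obtain g where "\<forall>k\<in>clusters I. g k \<in> cluster I z0 k" by metis
  then have q: "?Q (z0, \<lambda>k. pt I (g k))" using z0 KMedians by auto
  have "finite (?f ` Collect ?Q)"
  proof (rule finite_subset)
    show "?f ` Collect ?Q \<subseteq> ?f ` ?S"
    proof safe
      fix z c assume a: "P z" "admissible s I z c"
      have "COST I z c = ?f (restrict_assignment I z, restrict c (clusters I))"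
        by (simp add: COST_restrict) (intro COST_cong_c, simp)
      moreover have "(restrict_assignment I z, restrict c (clusters I)) \<in> ?S"
        using a P KMedians by (auto simp: cluster_def)
      ultimately show "COST I z c \<in> ?f ` ?S" by (rule image_eqI)
    qed
    show "finite (?f ` ?S)" by (intro finite_imageI finite_cartesian_product finite_assignments finite_PiE) auto
  qed
  from is_arg_min_exists_finite[where P="?Q", OF q this] show ?thesis by auto
qed

lemma optima_exist:
  assumes "feasible_inst s I"
  shows "\<exists>z c. optimal_fair_solution s I z c"
    and "\<exists>c. optimal_unfair_centers s I c"
    and "\<exists>z. optimal_fair_assignment_to I c z"
proof -
  obtain z0 where I: "mrfc_inst s I" and z0: "fair_assignment I z0" using assms by (auto simp: feasible_inst_def)
  then have c0: "clustering I z0" by (simp add: fair_assignment_def)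
  show "\<exists>z c. optimal_fair_solution s I z c" unfolding optimal_fair_solution_def
    using exists_optimal_solution[where P="fair_assignment I" and s=s, OF I _ z0] by (auto simp: fair_assignment_def)
  show "\<exists>c. optimal_unfair_centers s I c" unfolding optimal_unfair_centers_def
    using exists_optimal_solution[where P="clustering I" and s=s, OF I _ c0] by blast
  show "\<exists>z. optimal_fair_assignment_to I c z" unfolding optimal_fair_assignment_to_def
    by (rule is_arg_min_exists_finite[where P="fair_assignment I", OF z0]) (auto intro!: finite_COST_fixed_centers simp: fair_assignment_def)
qed
end

theory Submission
  imports Defs
begin

text \<open>
  For every \<open>L \<ge> 1\<close> there is an instance on the real line whose fair optimum is at most \<open>1\<close>,
  although every fair assignment to optimal unfair centers costs at least \<open>L\<close>.
  Two red points share the location \<open>0\<close>, two blue points lie at \<open>L\<close> and \<open>L + 1\<close>, there are three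
  clusters, and fairness (\<open>\<alpha> = 1\<close>) asks for two clusters that are entirely red.

  Without fairness there is a clustering of cost \<open>0\<close>, since there are only three locations. In a
  clustering of cost \<open>0\<close> every point sits on the center of its cluster, so the centers are
  exactly the three locations, each used once (\<open>zero_cost_centers\<close>). Hence only one optimal
  unfair center is at \<open>0\<close>. A fair assignment has two nonempty red clusters; one of them is
  served from \<open>L\<close> or \<open>L + 1\<close>, and any red point in it already pays at least \<open>L\<close>
  (\<open>gap_FA_cost\<close>). With freely chosen centers it is much cheaper to split the red points into two
  clusters with centers at \<open>0\<close> and to merge the two blue points, at cost \<open>1\<close>
  (\<open>gap_fair_optimum\<close>). The argument only compares locations with one another, so it serves both
  settings; squaring a distance that is at least \<open>1\<close> only enlarges the gap.
\<close>

section \<open>Clusterings of cost zero\<close>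

lemma cost_fn_nonneg_eq_0_iff:
  assumes "cost_fn_ok s I" "x \<in> euclid (dim I)" "c \<in> euclid (dim I)"
  shows "0 \<le> cost_fn I x c" and "cost_fn I x c = 0 \<longleftrightarrow> x = c"
proof -
  have "0 \<le> cost_fn I x c \<and> (cost_fn I x c = 0 \<longleftrightarrow> x = c)"
  proof (cases s)
    case KMeans
    have "(\<forall>j<dim I. x j = c j) \<longleftrightarrow> x = c"
      using assms(2,3) by (auto simp: topspace_Euclidean_space fun_eq_iff) (metis not_le)
    then show ?thesis
      using assms KMeans by (simp add: L2_set_eq_0_iff) auto
  next
    case KMedians
    then interpret Metric_space "euclid (dim I)" "cost_fn I"
      using assms(1) by simp
    show ?thesis
      using assms(2,3) by simp
  qed
  then show "0 \<le> cost_fn I x c" and "cost_fn I x c = 0 \<longleftrightarrow> x = c"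
    by auto
qed

lemma admissible_in_euclid:
  assumes "mrfc_inst s I" "admissible s I z c" "k \<in> clusters I"
  shows "c k \<in> euclid (dim I)"
  using assms by (cases s) (auto simp: mrfc_inst_def cluster_def)

text \<open>
  The centers are only required to lie in the ambient space: the bound is needed for fair
  assignments to fixed centers, and in the k-medians setting such centers need not belong to
  the clusters they serve.
\<close>

lemma cost_fn_le_COST:
  assumes "mrfc_inst s I" "\<And>k. k \<in> clusters I \<Longrightarrow> c k \<in> euclid (dim I)"
    and "i \<in> indices I" "k \<in> clusters I" "z i k = 1"
  shows "cost_fn I (pt I i) (c k) \<le> COST I z c"
proof -
  have nonneg: "0 \<le> cost_fn I (pt I i') (c k') * real (z i' k')"
    if "i' \<in> indices I" "k' \<in> clusters I" for i' k'
    using that assms(1,2) cost_fn_nonneg_eq_0_iff(1)[of s I] by (auto simp: mrfc_inst_def)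
  have "cost_fn I (pt I i) (c k) * real (z i k)
      \<le> (\<Sum>k\<in>clusters I. cost_fn I (pt I i) (c k) * real (z i k))"
    using assms(3,4) nonneg by (intro member_le_sum) auto
  also have "\<dots> \<le> COST I z c"
    unfolding COST_def using assms(3) nonneg
    by (intro member_le_sum[where f="\<lambda>i. \<Sum>k\<in>clusters I. cost_fn I (pt I i) (c k) * real (z i k)"])
      (auto intro!: sum_nonneg)
  finally show ?thesis
    using assms(5) by simp
qed

lemma clustering_obtains_cluster:
  assumes "clustering I z" "i \<in> indices I"
  obtains k where "k \<in> clusters I" "z i k = 1"
proof -
  have "(\<Sum>k\<in>clusters I. z i k) \<noteq> 0"
    using assms by (simp add: clustering_def)
  then obtain k where "k \<in> clusters I" "z i k \<noteq> 0"
    by (meson sum.neutral)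
  then show thesis
    using assms that[of k] unfolding clustering_def by fastforce
qed

text \<open>
  Every point lies on the center of its cluster, and every center has a point because clusters
  are nonempty. Clusters without points would leave some centers of an optimal solution
  undetermined.
\<close>

lemma zero_cost_centers:
  assumes I: "mrfc_inst s I" and z: "clustering I z" and c: "admissible s I z c"
    and cost: "COST I z c \<le> 0"
  shows "c ` clusters I = pt I ` indices I"
proof -
  have eu: "\<And>k. k \<in> clusters I \<Longrightarrow> c k \<in> euclid (dim I)"
    using I c by (rule admissible_in_euclid)
  have at_center: "c k = pt I i" if "i \<in> indices I" "k \<in> clusters I" "z i k = 1" for i k
  proof -
    have "cost_fn I (pt I i) (c k) \<le> 0"
      using cost_fn_le_COST[where z=z and c=c and i=i and k=k, OF I eu that] cost by simp
    then show ?thesis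
      using cost_fn_nonneg_eq_0_iff[of s I "pt I i" "c k"] I eu that
      by (auto simp: mrfc_inst_def)
  qed
  show ?thesis
  proof (intro equalityI subsetI)
    fix p assume "p \<in> c ` clusters I"
    then obtain k where k: "k \<in> clusters I" "p = c k"
      by auto
    then obtain i where "i \<in> cluster I z k"
      using z unfolding clustering_def by blast
    then show "p \<in> pt I ` indices I"
      using at_center k by (auto simp: cluster_def)
  next
    fix p assume "p \<in> pt I ` indices I"
    then obtain i where i: "i \<in> indices I" "p = pt I i"
      by auto
    then obtain k where "k \<in> clusters I" "z i k = 1"
      using z clustering_obtains_cluster by blast
    then show "p \<in> c ` clusters I"
      using at_center[of i k] i by force
  qed
qed

section \<open>Assignments given by a map from points to clusters\<close>

definition assignment_of :: "(nat \<Rightarrow> nat) \<Rightarrow> assignment" where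
  "assignment_of a i k = of_bool (a i = k)"

lemma cluster_assignment_of: "cluster I (assignment_of a) k = {i \<in> indices I. a i = k}"
  by (auto simp: cluster_def assignment_of_def)

lemma clustering_assignment_of:
  assumes "a ` indices I = clusters I"
  shows "clustering I (assignment_of a)"
proof -
  have "(\<Sum>k\<in>clusters I. assignment_of a i k) = 1" if "i \<in> indices I" for i
    using that assms by (auto simp: assignment_of_def of_bool_def)
  moreover have "cluster I (assignment_of a) k \<noteq> {}" if "k \<in> clusters I" for k
    using that assms by (force simp: cluster_assignment_of)
  ultimately show ?thesis
    by (simp add: clustering_def) (simp add: assignment_of_def)
qed

lemma COST_assignment_of:
  assumes "a ` indices I = clusters I"
  shows "COST I (assignment_of a) c = (\<Sum>i\<in>indices I. cost_fn I (pt I i) (c (a i)))"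
  unfolding COST_def
proof (intro sum.cong refl)
  fix i assume i: "i \<in> indices I"
  have "(\<Sum>k\<in>clusters I. cost_fn I (pt I i) (c k) * real (assignment_of a i k))
      = (\<Sum>k\<in>clusters I. if a i = k then cost_fn I (pt I i) (c k) else 0)"
    by (intro sum.cong) (auto simp: assignment_of_def)
  also have "\<dots> = cost_fn I (pt I i) (c (a i))"
    using i assms by auto
  finally show "(\<Sum>k\<in>clusters I. cost_fn I (pt I i) (c k) * real (assignment_of a i k))
      = cost_fn I (pt I i) (c (a i))" .
qed

section \<open>Instances with an arbitrarily large gap\<close>

definition gap_point :: "real \<Rightarrow> nat \<Rightarrow> point" where
  "gap_point L i j = (if j = 0 then (if i \<le> 2 then 0 else if i = 3 then L else L + 1) else 0)"

definition gap_cost :: "setting \<Rightarrow> point \<Rightarrow> point \<Rightarrow> real" where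
  "gap_cost s x c = (case s of KMeans \<Rightarrow> (x 0 - c 0)\<^sup>2 | KMedians \<Rightarrow> \<bar>x 0 - c 0\<bar>)"

text \<open>Group \<open>0\<close> is red, group \<open>1\<close> is blue; fairness demands two clusters for red alone.\<close>

definition gap_inst :: "setting \<Rightarrow> real \<Rightarrow> mrfc" where
  "gap_inst s L =
     \<lparr>dim = 1, npoints = 4, pt = gap_point L, features = {0}, vals = (\<lambda>_. {0, 1}),
      members = (\<lambda>g. if g = 0 then {1, 2} else {3, 4}), nclusters = 3, alpha = 1,
      beta = (\<lambda>g. if g = 0 then 2 else 0), cost_fn = gap_cost s\<rparr>"

lemma gap_inst_simps [simp]:
  "dim (gap_inst s L) = 1"
  "pt (gap_inst s L) = gap_point L"
  "npoints (gap_inst s L) = 4"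
  "nclusters (gap_inst s L) = 3"
  "features (gap_inst s L) = {0}"
  "vals (gap_inst s L) f = {0, 1}"
  "alpha (gap_inst s L) = 1"
  "cost_fn (gap_inst s L) = gap_cost s"
  "indices (gap_inst s L) = {1, 2, 3, 4}"
  "clusters (gap_inst s L) = {1, 2, 3}"
  "groups (gap_inst s L) = {0, 1}"
  "members (gap_inst s L) 0 = {1, 2}"
  "members (gap_inst s L) (Suc 0) = {3, 4}"
  "beta (gap_inst s L) 0 = 2"
  "beta (gap_inst s L) (Suc 0) = 0"
  by (auto simp: gap_inst_def indices_def clusters_def groups_def)

lemma gap_point_in_euclid: "gap_point L i \<in> euclid 1"
  by (auto simp: gap_point_def topspace_Euclidean_space)

lemma gap_cost_ok: "cost_fn_ok s (gap_inst s L)"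
proof (cases s)
  case KMeans
  then show ?thesis
    by (simp add: gap_cost_def L2_set_def)
next
  case KMedians
  have "Metric_space (euclid 1) (gap_cost KMedians)"
  proof
    fix x y assume "x \<in> euclid 1" "y \<in> euclid 1"
    then show "gap_cost KMedians x y = 0 \<longleftrightarrow> x = y"
      by (auto simp: gap_cost_def topspace_Euclidean_space fun_eq_iff)
        (metis One_nat_def Suc_leI neq0_conv)
  qed (auto simp: gap_cost_def)
  then show ?thesis
    using KMedians by simp
qed

lemma gap_inst_ok: "mrfc_inst s (gap_inst s L)"
proof -
  have "partition_on {1, 2, 3, 4::nat} {{1, 2}, {3, 4}}"
    by (auto simp: partition_on_def disjoint_def)
  moreover have "inj_on (members (gap_inst s L)) {0, 1}"
    by (auto simp: gap_inst_def doubleton_eq_iff)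
  ultimately show ?thesis
    using gap_cost_ok[of s L] gap_point_in_euclid[of L]
    by (simp add: mrfc_inst_def)
qed

text \<open>The two red points are separated and the two blue points are merged.\<close>

lemma gap_fair_solution:
  defines "z \<equiv> assignment_of (\<lambda>i. min i 3)"
  shows "fair_assignment (gap_inst s L) z"
    and "admissible s (gap_inst s L) z (gap_point L)"
    and "COST (gap_inst s L) z (gap_point L) = 1"
proof -
  let ?I = "gap_inst s L"
  have im: "(\<lambda>i. min i 3) ` indices ?I = clusters ?I"
    by auto
  have cl: "cluster ?I z 1 = {1}" "cluster ?I z 2 = {2}" "cluster ?I z 3 = {3, 4}"
    by (auto simp: z_def cluster_assignment_of min_def)
  have "{1, 2} \<subseteq> {k \<in> clusters ?I. real (card (cluster ?I z k \<inter> members ?I 0))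
      \<ge> alpha ?I * real (card (cluster ?I z k))}" (is "_ \<subseteq> ?R")
    using cl by simp
  then have "card {1, 2::nat} \<le> card ?R"
    by (intro card_mono) auto
  then show "fair_assignment ?I z"
    using clustering_assignment_of[OF im] by (simp add: fair_assignment_def z_def)
  show "admissible s ?I z (gap_point L)"
    using cl gap_point_in_euclid[of L] by (cases s) auto
  show "COST ?I z (gap_point L) = 1"
    using COST_assignment_of[OF im, of "gap_point L"]
    by (simp add: z_def gap_cost_def gap_point_def split: setting.split)
qed

lemma gap_feasible: "feasible_inst s (gap_inst s L)"
  unfolding feasible_inst_def using gap_inst_ok gap_fair_solution(1) by blast

lemma gap_fair_optimum:
  assumes "optimal_fair_solution s (gap_inst s L) z c"
  shows "COST (gap_inst s L) z c \<le> 1"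
  using assms gap_fair_solution[of s L]
  by (force simp: optimal_fair_solution_def is_arg_min_def simp del: admissible.simps)

lemma gap_unfair_centers:
  assumes "optimal_unfair_centers s (gap_inst s L) c"
  shows "c ` {1, 2, 3} = {gap_point L 1, gap_point L 3, gap_point L 4}"
proof -
  let ?I = "gap_inst s L"
  \<comment> \<open>The clusters are the red points and the two blue singletons.\<close>
  let ?a = "\<lambda>i::nat. max 1 (i - 1)"
  let ?z = "assignment_of ?a"
  let ?c = "\<lambda>k. gap_point L (k + 1)"
  have im: "?a ` indices ?I = clusters ?I"
    by auto
  have in_cluster: "k + 1 \<in> cluster ?I ?z k" if "k \<in> clusters ?I" for k
    using that by (auto simp: cluster_assignment_of)
  have adm: "admissible s ?I ?z ?c"
  proof (cases s)
    case KMeans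
    then show ?thesis
      using gap_point_in_euclid[of L] by simp
  next
    case KMedians
    show ?thesis
      unfolding KMedians admissible.simps gap_inst_simps(2)
      using in_cluster[unfolded KMedians] by blast
  qed
  have zero: "COST ?I ?z ?c = 0"
    using COST_assignment_of[OF im, of ?c]
    by (simp add: gap_cost_def gap_point_def split: setting.split)
  obtain z where z: "clustering ?I z" "admissible s ?I z c"
      and min: "\<not> COST ?I ?z ?c < COST ?I z c"
    using assms clustering_assignment_of[OF im] adm
    by (auto simp: optimal_unfair_centers_def is_arg_min_def simp del: admissible.simps)
  have "c ` clusters ?I = pt ?I ` indices ?I"
    using gap_inst_ok z by (rule zero_cost_centers) (use min zero in simp)
  moreover have "gap_point L 2 = gap_point L 1"
    by (simp add: gap_point_def fun_eq_iff)
  ultimately show ?thesis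
    by simp
qed

text \<open>
  Three distinct locations force three distinct centers, so the two red clusters cannot both be
  served from the location of the red points.
\<close>

lemma gap_FA_cost:
  assumes L: "L \<ge> 1" and c: "optimal_unfair_centers s (gap_inst s L) c"
    and z: "fair_assignment (gap_inst s L) z"
  shows "L \<le> COST (gap_inst s L) z c"
proof -
  let ?I = "gap_inst s L"
  let ?R = "{k \<in> clusters ?I. real (card (cluster ?I z k \<inter> members ?I 0))
      \<ge> alpha ?I * real (card (cluster ?I z k))}"
  have locs: "c ` {1, 2, 3} = {gap_point L 1, gap_point L 3, gap_point L 4}"
    using c by (rule gap_unfair_centers)
  have "gap_point L 1 0 \<noteq> gap_point L 3 0" "gap_point L 1 0 \<noteq> gap_point L 4 0"
      "gap_point L 3 0 \<noteq> gap_point L 4 0"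
    using L by (auto simp: gap_point_def)
  then have "card (c ` {1, 2, 3}) = 3"
    unfolding locs by (auto simp: card_insert_if)
  then have inj: "inj_on c {1, 2, 3}"
    by (intro eq_card_imp_inj_on) auto
  have "2 \<le> card ?R"
    using z by (auto simp: fair_assignment_def)
  moreover have "finite ?R"
    by simp
  ultimately obtain k k' where kk: "k \<in> ?R" "k' \<in> ?R" "k \<noteq> k'"
    by (metis (no_types, lifting) card_le_Suc0_iff_eq not_less_eq_eq numeral_2_eq_2)
  then obtain k where k: "k \<in> ?R" "c k \<noteq> gap_point L 1"
    using inj unfolding inj_on_def by (metis (no_types, lifting) gap_inst_simps(10) mem_Collect_eq)
  have fin: "finite (cluster ?I z k)"
    by (simp add: cluster_def)
  have "card (cluster ?I z k) \<le> card (cluster ?I z k \<inter> {1, 2})"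
    using k(1) by simp
  then have red: "cluster ?I z k \<subseteq> {1, 2}"
    using card_seteq[OF fin, of "cluster ?I z k \<inter> {1, 2}"] by auto
  have "cluster ?I z k \<noteq> {}"
    using z k(1) unfolding fair_assignment_def clustering_def by blast
  then obtain i where i: "i \<in> {1, 2}" "z i k = 1"
    using red by (auto simp: cluster_def)
  have eu: "c k \<in> euclid (dim ?I)" if "k \<in> clusters ?I" for k
  proof -
    have "c k \<in> c ` {1, 2, 3}"
      using that by auto
    then show ?thesis
      unfolding locs using gap_point_in_euclid[of L] by auto
  qed
  have "c k \<in> c ` {1, 2, 3}"
    using k(1) by auto
  then have ck: "c k = gap_point L 3 \<or> c k = gap_point L 4"
    unfolding locs using k(2) by auto
  have "L \<le> \<bar>gap_point L i 0 - c k 0\<bar>"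
    using ck i L by (auto simp: gap_point_def)
  also have "\<dots> \<le> gap_cost s (gap_point L i) (c k)"
  proof (cases s)
    case KMeans
    have "1 \<le> \<bar>gap_point L i 0 - c k 0\<bar>"
      using ck i L by (auto simp: gap_point_def)
    then have "\<bar>gap_point L i 0 - c k 0\<bar> \<le> \<bar>gap_point L i 0 - c k 0\<bar>\<^sup>2"
      by (rule self_le_power) simp
    then show ?thesis
      using KMeans by (simp add: gap_cost_def)
  next
    case KMedians
    then show ?thesis
      by (simp add: gap_cost_def)
  qed
  also have "\<dots> \<le> COST ?I z c"
    using cost_fn_le_COST[where I="?I" and i=i and k=k and z=z and c=c, OF gap_inst_ok eu] i k(1)
    by auto
  finally show ?thesis .
qed

theorem theorem3:
  fixes s :: setting
    and z_opt z_FA :: "mrfc \<Rightarrow> assignment"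
    and c_opt c_UF :: "mrfc \<Rightarrow> centers"
  assumes "\<And>I. feasible_inst s I \<Longrightarrow> optimal_fair_solution s I (z_opt I) (c_opt I)"
    and "\<And>I. feasible_inst s I \<Longrightarrow> optimal_unfair_centers s I (c_UF I)"
    and "\<And>I. feasible_inst s I \<Longrightarrow> optimal_fair_assignment_to I (c_UF I) (z_FA I)"
  shows "\<not> (\<exists>\<Gamma>>0. \<forall>I. feasible_inst s I \<longrightarrow>
           COST I (z_FA I) (c_UF I) \<le> \<Gamma> * COST I (z_opt I) (c_opt I))"
proof
  assume "\<exists>\<Gamma>>0. \<forall>I. feasible_inst s I \<longrightarrow>
           COST I (z_FA I) (c_UF I) \<le> \<Gamma> * COST I (z_opt I) (c_opt I)"
  then obtain \<Gamma> where \<Gamma>: "\<Gamma> > 0"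
    and bound: "\<And>I. feasible_inst s I \<Longrightarrow>
           COST I (z_FA I) (c_UF I) \<le> \<Gamma> * COST I (z_opt I) (c_opt I)"
    by blast
  let ?I = "gap_inst s (\<Gamma> + 1)"
  have feas: "feasible_inst s ?I"
    by (rule gap_feasible)
  have "fair_assignment ?I (z_FA ?I)"
    using assms(3)[OF feas] by (simp add: optimal_fair_assignment_to_def is_arg_min_def)
  then have "\<Gamma> + 1 \<le> COST ?I (z_FA ?I) (c_UF ?I)"
    using \<Gamma> assms(2)[OF feas] by (intro gap_FA_cost) auto
  also have "\<dots> \<le> \<Gamma> * COST ?I (z_opt ?I) (c_opt ?I)"
    using feas by (rule bound)
  also have "\<dots> \<le> \<Gamma> * 1"
    using \<Gamma> gap_fair_optimum[OF assms(1)[OF feas]] by (intro mult_left_mono) auto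
  finally show False
    by simp
qed

end
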